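(* Let $\mathcal{H}$ be a separable Hilbert space, and let $\mathcal{G}=\{g_j\}_{j\ge1}$ be a Bessel sequence in $\mathcal{H}$. Let $W$ be a closed subspace of $\mathcal{H}$ and let $P_W:\mathcal{H}\to\mathcal{H}$ be the orthogonal projection onto $W$. Let $A$ be a bounded linear operator on $\mathcal{H}$ with $1\notin\sigma(A)$, and consider the dynamical system $x_{n+1}=Ax_n+w$, $n\ge0$, with arbitrary initial state $x_0\in\mathcal{H}$ and source term $w\in W$. If the source term $w\in W$ can be recovered from the measurements $\mathcal{D}(x_0,w)=[\langle x_n,g_j\rangle]_{n\in[N],\,j\ge1}$ in a stable way for some $1\le N<\infty$, then $\{P_W(I-A^* )^{-1}g_j\}_{j\ge1}$ is a frame for $W$.
   Context: Hilbert spaces are complex; $\sigma(A)$ denotes the spectrum of $A$ and $I$ the identity operator. A sequence $\{g_j\}_{j\ge1}$ in $\mathcal{H}$ is a Bessel sequence if there is $C<\infty$ with $\sum_{j}|\langle h,g_j\rangle|^2\le C\|h\|^2$ for all $h\in\mathcal{H}$. A sequence $\{f_j\}_{j\ge1}\subset W$ is a frame for $W$ if there are constants $0<c\le C<\infty$ with $c\|w\|^2\le\sum_j|\langle w,f_j\rangle|^2\le C\|w\|^2$ for all $w\in W$. For $N\ge1$, $[N]=\{0,1,\dots,N-1\}$. The space $\mathcal{B}(\ell^2,\mathbb{C}^N)$ consists of all complex matrices $D=[d_{nj}]_{n\in[N],\,j\ge1}$ with $N$ rows, each row $(d_{n1},d_{n2},\dots)$ belonging to $\ell^2$, endowed with the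 norm $\|D\|=\sum_{n=0}^{N-1}\big(\sum_{j=1}^\infty|d_{nj}|^2\big)^{1/2}$. Stable recovery (finitely many iterations $N$, sources in $W$): the source term can be recovered from $\mathcal{D}(x_0,w)=[\langle x_n,g_j\rangle]_{n\in[N],\,j\ge1}$ in a stable way if there exists a bounded linear operator $\mathcal{R}:\mathcal{B}(\ell^2,\mathbb{C}^N)\to\mathcal{H}$ such that $\mathcal{R}(\mathcal{D}(x_0,w))=w$ for all $x_0\in\mathcal{H}$ and all $w\in W$, where $(x_n)$ is the orbit of the system generated by $x_0$ and $w$. *)

theory Defs
  imports "HOL-Analysis.Analysis"
begin

section \<open>Complex Hilbert spaces\<close>

text \<open>
  The inner product is linear in the first argument and conjugate-linear in the second.
  Symmetry together with \<open>cinner_self\<close> (and the norm axioms of \<^class>\<open>banach\<close>) makes it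
  positive definite with \<open>norm\<close> as its norm; completeness is part of \<^class>\<open>banach\<close>.
\<close>

class chilbert_space = banach +
  fixes scaleC :: "complex \<Rightarrow> 'a \<Rightarrow> 'a" (infixr "*\<^sub>C" 75)
    and cinner :: "'a \<Rightarrow> 'a \<Rightarrow> complex"
  assumes scaleC_add_right: "a *\<^sub>C (x + y) = a *\<^sub>C x + a *\<^sub>C y"
    and scaleC_add_left: "(a + b) *\<^sub>C x = a *\<^sub>C x + b *\<^sub>C x"
    and scaleC_scaleC: "a *\<^sub>C (b *\<^sub>C x) = (a * b) *\<^sub>C x"
    and scaleR_scaleC: "r *\<^sub>R x = complex_of_real r *\<^sub>C x"
    and cinner_commute: "cinner x y = cnj (cinner y x)"
    and cinner_add_left: "cinner (x + y) z = cinner x z + cinner y z"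
    and cinner_scaleC_left: "cinner (a *\<^sub>C x) y = a * cinner x y"
    and cinner_self: "cinner x x = complex_of_real ((norm x)\<^sup>2)"

instantiation complex :: chilbert_space
begin
definition scaleC_complex :: "complex \<Rightarrow> complex \<Rightarrow> complex"
  where "scaleC_complex a x = a * x"
definition cinner_complex :: "complex \<Rightarrow> complex \<Rightarrow> complex"
  where "cinner_complex x y = x * cnj y"
instance
proof (standard, goal_cases)
  case (8 x)
  then show ?case
    unfolding cinner_complex_def by (metis complex_norm_square)
qed (simp_all add: scaleC_complex_def cinner_complex_def algebra_simps scaleR_conv_of_real)
end

section \<open>Operators and subspaces\<close>

definition bounded_clinear :: "('a::chilbert_space \<Rightarrow> 'b::chilbert_space) \<Rightarrow> bool"
  where "bounded_clinear T \<longleftrightarrow> bounded_linear T \<and> (\<forall>c x. T (c *\<^sub>C x) = c *\<^sub>C T x)"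

definition closed_csubspace :: "'a::chilbert_space set \<Rightarrow> bool"
  where "closed_csubspace W \<longleftrightarrow> subspace W \<and> (\<forall>c. \<forall>x\<in>W. c *\<^sub>C x \<in> W) \<and> closed W"

definition spectrum :: "('a::chilbert_space \<Rightarrow> 'a) \<Rightarrow> complex set"
  where "spectrum T = {z. \<not> (\<exists>S. bounded_clinear S \<and>
    (\<forall>x. S (T x - z *\<^sub>C x) = x) \<and> (\<forall>x. T (S x) - z *\<^sub>C S x = x))}"

text \<open>
  The definite descriptions below denote uniquely existing objects for bounded operators \<open>T\<close>
  (Riesz) and closed subspaces \<open>W\<close> (projection theorem), respectively.
\<close>

definition cadjoint :: "('a::chilbert_space \<Rightarrow> 'b::chilbert_space) \<Rightarrow> 'b \<Rightarrow> 'a"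
  where "cadjoint T = (THE S. \<forall>x y. cinner (T x) y = cinner x (S y))"

definition orth_proj :: "'a::chilbert_space set \<Rightarrow> 'a \<Rightarrow> 'a"
  where "orth_proj W x = (THE p. p \<in> W \<and> (\<forall>w\<in>W. cinner (x - p) w = 0))"

section \<open>Bessel sequences and frames\<close>

text \<open>
  Sequences indexed by \<open>j \<ge> 1\<close> are functions on \<^typ>\<open>nat\<close>, that is, re-indexed from \<open>0\<close>.
  Summability is required explicitly because \<^const>\<open>suminf\<close> carries no information for
  divergent series.
\<close>

definition bessel_sequence :: "(nat \<Rightarrow> 'a::chilbert_space) \<Rightarrow> bool"
  where "bessel_sequence g \<longleftrightarrow> (\<exists>C. \<forall>h.
    summable (\<lambda>j. (cmod (cinner h (g j)))\<^sup>2) \<and>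
    (\<Sum>j. (cmod (cinner h (g j)))\<^sup>2) \<le> C * (norm h)\<^sup>2)"

definition frame_for :: "'a::chilbert_space set \<Rightarrow> (nat \<Rightarrow> 'a) \<Rightarrow> bool"
  where "frame_for W f \<longleftrightarrow> (\<forall>j. f j \<in> W) \<and> (\<exists>c C. 0 < c \<and> c \<le> C \<and> (\<forall>w\<in>W.
    summable (\<lambda>j. (cmod (cinner w (f j)))\<^sup>2) \<and>
    c * (norm w)\<^sup>2 \<le> (\<Sum>j. (cmod (cinner w (f j)))\<^sup>2) \<and>
    (\<Sum>j. (cmod (cinner w (f j)))\<^sup>2) \<le> C * (norm w)\<^sup>2))"

section \<open>Data matrices and stable recovery\<close>

text \<open>
  An \<open>N\<close>-rowed matrix is a function \<open>D n j\<close> that vanishes for \<open>n \<ge> N\<close>, so that each matrix has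
  exactly one representation.
\<close>

definition ell2_matrices :: "nat \<Rightarrow> (nat \<Rightarrow> nat \<Rightarrow> complex) set"
  where "ell2_matrices N = {D. (\<forall>n<N. summable (\<lambda>j. (cmod (D n j))\<^sup>2)) \<and> (\<forall>n\<ge>N. \<forall>j. D n j = 0)}"

definition matrix_norm :: "nat \<Rightarrow> (nat \<Rightarrow> nat \<Rightarrow> complex) \<Rightarrow> real"
  where "matrix_norm N D = (\<Sum>n<N. sqrt (\<Sum>j. (cmod (D n j))\<^sup>2))"

definition bounded_matrix_operator ::
    "nat \<Rightarrow> ((nat \<Rightarrow> nat \<Rightarrow> complex) \<Rightarrow> 'a::chilbert_space) \<Rightarrow> bool"
  where "bounded_matrix_operator N R \<longleftrightarrow>
    (\<forall>D\<in>ell2_matrices N. \<forall>E\<in>ell2_matrices N. R (\<lambda>n j. D n j + E n j) = R D + R E) \<and>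
    (\<forall>c. \<forall>D\<in>ell2_matrices N. R (\<lambda>n j. c * D n j) = c *\<^sub>C R D) \<and>
    (\<exists>K. \<forall>D\<in>ell2_matrices N. norm (R D) \<le> K * matrix_norm N D)"

primrec orbit :: "('a::chilbert_space \<Rightarrow> 'a) \<Rightarrow> 'a \<Rightarrow> 'a \<Rightarrow> nat \<Rightarrow> 'a"
  where
    "orbit A x\<^sub>0 w 0 = x\<^sub>0"
  | "orbit A x\<^sub>0 w (Suc n) = A (orbit A x\<^sub>0 w n) + w"

definition measurements ::
    "('a::chilbert_space \<Rightarrow> 'a) \<Rightarrow> (nat \<Rightarrow> 'a) \<Rightarrow> nat \<Rightarrow> 'a \<Rightarrow> 'a \<Rightarrow> nat \<Rightarrow> nat \<Rightarrow> complex"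
  where "measurements A g N x\<^sub>0 w =
    (\<lambda>n j. if n < N then cinner (orbit A x\<^sub>0 w n) (g j) else 0)"

definition stably_recoverable ::
    "('a::chilbert_space \<Rightarrow> 'a) \<Rightarrow> (nat \<Rightarrow> 'a) \<Rightarrow> 'a set \<Rightarrow> nat \<Rightarrow> bool"
  where "stably_recoverable A g W N \<longleftrightarrow> (\<exists>R. bounded_matrix_operator N R \<and>
    (\<forall>x\<^sub>0. \<forall>w\<in>W. R (measurements A g N x\<^sub>0 w) = w))"

end

theory Submission
  imports Defs
begin

text \<open>
  The fixed points of the system are what tie recovery to a frame. Since \<open>1\<close> is not in the spectrum
  of \<open>A\<close>, the operator \<open>S = (I - A)\<inverse>\<close> exists and is bounded, and \<open>x = S w\<close> is the unique solution
  of \<open>A x + w = x\<close>. Started at \<open>S w\<close>, the orbit with source \<open>w\<close> never moves, so the data matrix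
  consists of \<open>N\<close> copies of the single row \<open>\<langle>S w, g\<^sub>j\<rangle>\<close>, and its norm is \<open>N\<close> times the \<open>\<ell>\<^sup>2\<close> norm of that
  row. A bounded recovery operator must return \<open>w\<close> from this matrix, which bounds \<open>\<parallel>w\<parallel>\<close> by a multiple
  of that \<open>\<ell>\<^sup>2\<close> norm: this is the lower frame bound. The upper one is the Bessel bound of \<open>g\<close> at \<open>S w\<close>
  together with the boundedness of \<open>S\<close>.

  What remains is the identity \<open>\<langle>S w, g\<^sub>j\<rangle> = \<langle>w, P\<^sub>W (I - A\<^sup>*)\<inverse> g\<^sub>j\<rangle>\<close> for \<open>w \<in> W\<close>, that is, \<open>S\<^sup>* = (I - A\<^sup>*)\<inverse>\<close>
  (\<open>inv_id_minus_cadjoint\<close>) and the self-adjointness of \<open>P\<^sub>W\<close> (\<open>cinner_orth_proj\<close>). Adjoints and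
  projections are given by definite descriptions, so their existence has to be established:
  the projection theorem comes from minimising the distance to a closed subspace, the Riesz
  representation theorem from projecting onto the kernel of a functional, and adjoints from
  Riesz.
\<close>

section \<open>Inner product and norm\<close>

lemma cinner_add_right: "cinner x (y + z) = cinner x y + cinner x (z::'a::chilbert_space)"
  by (metis cinner_add_left cinner_commute complex_cnj_add)

lemma cinner_scaleC_right: "cinner x (a *\<^sub>C y) = cnj a * cinner x (y::'a::chilbert_space)"
  by (metis cinner_commute cinner_scaleC_left complex_cnj_mult)

lemma cinner_zero_left [simp]: "cinner 0 (x::'a::chilbert_space) = 0"
  using cinner_add_left[of 0 0 x] by simp

lemma cinner_zero_right [simp]: "cinner (x::'a::chilbert_space) 0 = 0"
  using cinner_add_right[of x 0 0] by simp

lemma cinner_diff_left: "cinner (x - y) z = cinner x z - cinner y (z::'a::chilbert_space)"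
  using cinner_add_left[of "x - y" y z] by simp

lemma cinner_diff_right: "cinner x (y - z) = cinner x y - cinner x (z::'a::chilbert_space)"
  using cinner_add_right[of x "y - z" z] by simp

lemma cinner_eq_zero_iff [simp]: "cinner x x = 0 \<longleftrightarrow> (x::'a::chilbert_space) = 0"
  by (simp add: cinner_self)

lemma cinner_extensionality:
  assumes "\<And>u. cinner u x = cinner u (y::'a::chilbert_space)"
  shows "x = y"
  using assms[of "x - y"] cinner_eq_zero_iff[of "x - y"] by (simp add: cinner_diff_right)

lemma scaleC_one [simp]: "1 *\<^sub>C x = (x::'a::chilbert_space)"
  using scaleR_scaleC[of 1 x] by simp

lemma scaleC_minus_right: "a *\<^sub>C (- x) = - (a *\<^sub>C (x::'a::chilbert_space))"
proof -
  have "a *\<^sub>C 0 = (0::'a)" using scaleC_add_right[of a 0 "0::'a"] by simp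
  then show ?thesis using scaleC_add_right[of a x "- x"]
    by (simp add: eq_neg_iff_add_eq_0 add.commute)
qed

lemma norm_diff_squared:
  "(norm (x - y))\<^sup>2 = (norm x)\<^sup>2 - 2 * Re (cinner x y) + (norm (y::'a::chilbert_space))\<^sup>2"
proof -
  have "complex_of_real ((norm (x - y))\<^sup>2) = cinner x x - cinner x y - cinner y x + cinner y y"
    by (simp only: cinner_self[symmetric] cinner_diff_left cinner_diff_right) simp
  then have "(norm (x - y))\<^sup>2 = Re (cinner x x - cinner x y - cinner y x + cinner y y)"
    by (metis Re_complex_of_real)
  moreover have "Re (cinner y x) = Re (cinner x y)"
    by (subst cinner_commute) simp
  ultimately show ?thesis by (simp add: cinner_self)
qed

lemma parallelogram_law:
  "(norm (x + y))\<^sup>2 + (norm (x - y))\<^sup>2 = 2 * (norm x)\<^sup>2 + 2 * (norm (y::'a::chilbert_space))\<^sup>2"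
proof -
  have "cinner x (- y) = - cinner x y" using cinner_diff_right[of x 0 y] by simp
  then show ?thesis
    using norm_diff_squared[of x y] norm_diff_squared[of x "- y"] by simp
qed

text \<open>
  Expanding \<open>\<parallel>x - a y\<parallel>\<^sup>2\<close> at \<open>a = t \<langle>x, y\<rangle>\<close> with \<open>t\<close> real is the common source of the Cauchy--Schwarz
  inequality and of the orthogonality of a distance minimiser.
\<close>
lemma norm_diff_scaled_projection:
  "(norm (x - (complex_of_real t * cinner x y) *\<^sub>C y))\<^sup>2 =
     (norm x)\<^sup>2 + (t\<^sup>2 * (norm y)\<^sup>2 - 2 * t) * (cmod (cinner x (y::'a::chilbert_space)))\<^sup>2"
proof -
  let ?a = "complex_of_real t * cinner x y"
  have "cinner x (?a *\<^sub>C y) = complex_of_real (t * (cmod (cinner x y))\<^sup>2)"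
    by (simp only: cinner_scaleC_right complex_norm_square of_real_mult complex_cnj_mult
        complex_cnj_complex_of_real mult_ac)
  then have inner: "Re (cinner x (?a *\<^sub>C y)) = t * (cmod (cinner x y))\<^sup>2"
    by (metis Re_complex_of_real)
  have "complex_of_real ((norm (?a *\<^sub>C y))\<^sup>2) = complex_of_real ((cmod ?a)\<^sup>2 * (norm y)\<^sup>2)"
    unfolding of_real_mult complex_norm_square cinner_self[where 'a='a, symmetric]
    by (simp add: cinner_scaleC_left cinner_scaleC_right)
  then have "(norm (?a *\<^sub>C y))\<^sup>2 = (cmod ?a)\<^sup>2 * (norm y)\<^sup>2"
    by (simp only: of_real_eq_iff)
  then show ?thesis
    by (simp add: norm_diff_squared inner norm_mult power_mult_distrib algebra_simps)
qed

lemma Cauchy_Schwarz_cinner: "cmod (cinner x y) \<le> norm x * norm (y::'a::chilbert_space)"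
proof (cases "y = 0")
  case False
  let ?n = "(norm y)\<^sup>2"
  have pos: "?n > 0" using False by simp
  \<comment> \<open>The choice \<open>t = 1 / \<parallel>y\<parallel>\<^sup>2\<close> minimises the quadratic in \<open>t\<close>.\<close>
  have "0 \<le> (norm x)\<^sup>2 + ((1 / ?n)\<^sup>2 * ?n - 2 * (1 / ?n)) * (cmod (cinner x y))\<^sup>2"
    by (metis norm_diff_scaled_projection zero_le_power2)
  also have "(1 / ?n)\<^sup>2 * ?n - 2 * (1 / ?n) = - (1 / ?n)"
    using False by (simp add: power2_eq_square)
  finally have "(cmod (cinner x y))\<^sup>2 \<le> (norm x * norm y)\<^sup>2"
    using pos by (simp add: field_simps)
  then show ?thesis by (rule power2_le_imp_le) simp
qed simp

section \<open>Projection theorem\<close>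

text \<open>
  A minimising sequence is Cauchy: by the parallelogram law two points of \<open>W\<close> that are almost
  nearest to \<open>x\<close> are close to each other, because their midpoint is in \<open>W\<close> and hence no nearer
  to \<open>x\<close> than the infimum.
\<close>
lemma nearest_point_exists:
  fixes W :: "'a::chilbert_space set"
  assumes "closed W" "subspace W"
  shows "\<exists>p\<in>W. \<forall>w\<in>W. norm (x - p) \<le> norm (x - w)"
proof -
  define d where "d = infdist x W"
  have ne: "W \<noteq> {}" using assms(2) subspace_0 by blast
  have d_le: "d \<le> norm (x - w)" if "w \<in> W" for w
    using infdist_le[OF that, of x] by (simp add: d_def dist_norm)
  have d_nonneg: "0 \<le> d" by (simp add: d_def infdist_nonneg)
  have "\<exists>w\<in>W. norm (x - w) < d + 1 / real (Suc n)" for n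
  proof -
    have "(INF w\<in>W. dist x w) < d + 1 / real (Suc n)"
      using ne by (simp add: d_def infdist_def)
    then show ?thesis
      using ne by (subst (asm) cINF_less_iff) (auto simp: dist_norm intro: bdd_belowI2[where m=0])
  qed
  then obtain v where v: "\<And>n. v n \<in> W" "\<And>n. norm (x - v n) < d + 1 / real (Suc n)"
    by metis
  have close: "(norm (v m - v n))\<^sup>2 \<le> (8 * d + 4) / real (Suc k)" if "k \<le> m" "k \<le> n" for m n k
  proof -
    define e where "e = 1 / real (Suc k)"
    have e: "0 \<le> e" "e \<le> 1" by (auto simp: e_def)
    have near: "norm (x - v i) \<le> d + e" if "k \<le> i" for i
    proof -
      have "1 / real (Suc i) \<le> e" using that by (simp add: e_def frac_le)
      with v(2)[of i] show ?thesis by linarith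
    qed
    have "(1/2) *\<^sub>R (v m + v n) \<in> W"
      using v(1) assms(2) by (simp add: subspace_add subspace_scale)
    then have "d \<le> norm (x - (1/2) *\<^sub>R (v m + v n))" by (rule d_le)
    also have "x - (1/2) *\<^sub>R (v m + v n) = (1/2) *\<^sub>R ((x - v m) + (x - v n))"
      by (simp add: algebra_simps flip: scaleR_add_left)
    finally have "2 * d \<le> norm ((x - v m) + (x - v n))" by simp
    then have "(2 * d)\<^sup>2 \<le> (norm ((x - v m) + (x - v n)))\<^sup>2"
      using d_nonneg by (intro power_mono) auto
    moreover have "(norm (x - v i))\<^sup>2 \<le> (d + e)\<^sup>2" if "k \<le> i" for i
      using near[OF that] by (intro power_mono) auto
    moreover have "norm ((x - v m) - (x - v n)) = norm (v m - v n)"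
      by (simp add: norm_minus_commute)
    ultimately have "(norm (v m - v n))\<^sup>2 \<le> 4 * (d + e)\<^sup>2 - 4 * d\<^sup>2"
      using parallelogram_law[of "x - v m" "x - v n"] that
      by (smt (verit) power_mult_distrib four_x_squared)
    also have "\<dots> = 8 * d * e + 4 * (e * e)" by (simp add: power2_eq_square algebra_simps)
    also have "\<dots> \<le> 8 * d * e + 4 * (e * 1)"
      using e by (intro add_left_mono mult_left_mono) auto
    also have "\<dots> = (8 * d + 4) / real (Suc k)" by (simp add: e_def add_divide_distrib)
    finally show ?thesis .
  qed
  have "Cauchy v"
  proof (rule metric_CauchyI)
    fix r :: real assume "0 < r"
    obtain k where "(8 * d + 4) / r\<^sup>2 < real k" using reals_Archimedean2 by blast
    then have "(8 * d + 4) / real (Suc k) < r\<^sup>2"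
      using \<open>0 < r\<close> by (simp add: field_simps) (smt (verit) zero_less_power)
    then have "norm (v m - v n) < r" if "k \<le> m" "k \<le> n" for m n
      using close[OF that] \<open>0 < r\<close> by (intro power2_less_imp_less[of _ r]) auto
    then show "\<exists>M. \<forall>m\<ge>M. \<forall>n\<ge>M. dist (v m) (v n) < r" by (auto simp: dist_norm)
  qed
  then obtain p where p: "v \<longlonglongrightarrow> p" using Cauchy_convergent convergentD by blast
  have "p \<in> W" using closed_sequentially[OF assms(1)] v(1) p by blast
  have lim: "(\<lambda>n. norm (x - v n)) \<longlonglongrightarrow> norm (x - p)" by (intro tendsto_intros p)
  have "(\<lambda>n. d + 1 / real (Suc n)) \<longlonglongrightarrow> d + 0"
    by (intro tendsto_intros LIMSEQ_Suc lim_1_over_n)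
  then have "norm (x - p) \<le> d + 0"
    using lim v(2) by (intro LIMSEQ_le[OF lim]) (auto intro: less_imp_le)
  with \<open>p \<in> W\<close> d_le show ?thesis by force
qed

lemma orthogonal_decomposition_exists:
  assumes "closed_csubspace W"
  shows "\<exists>p\<in>W. \<forall>w\<in>W. cinner (x - p) w = 0"
proof -
  from assms have W: "closed W" "subspace W" "\<And>c w. w \<in> W \<Longrightarrow> c *\<^sub>C w \<in> W"
    by (auto simp: closed_csubspace_def)
  obtain p where p: "p \<in> W" "\<And>w. w \<in> W \<Longrightarrow> norm (x - p) \<le> norm (x - w)"
    using nearest_point_exists[OF W(1,2)] by metis
  have "cinner (x - p) w = 0" if "w \<in> W" for w
  proof -
    let ?s = "(cmod (cinner (x - p) w))\<^sup>2" and ?n = "(norm w)\<^sup>2"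
    \<comment> \<open>A small positive \<open>t\<close> makes the linear term of the quadratic dominate.\<close>
    define t where "t = 1 / (1 + ?n)"
    have t: "0 < t" "t * ?n < 1"
      by (simp_all add: t_def add_pos_nonneg)
    let ?u = "(complex_of_real t * cinner (x - p) w) *\<^sub>C w"
    have "p + ?u \<in> W" using p(1) that W by (simp add: subspace_add)
    then have "norm (x - p) \<le> norm (x - p - ?u)" using p(2) by (simp add: diff_diff_eq)
    then have "(norm (x - p))\<^sup>2 \<le> (norm (x - p - ?u))\<^sup>2" by (intro power_mono) auto
    then have "0 \<le> (t\<^sup>2 * ?n - 2 * t) * ?s" by (simp only: norm_diff_scaled_projection)
    moreover have "t\<^sup>2 * ?n - 2 * t < 0"
    proof -
      have "t\<^sup>2 * ?n - 2 * t = t * (t * ?n - 2)" by (simp add: power2_eq_square algebra_simps)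
      also have "\<dots> < 0" using t by (intro mult_pos_neg) auto
      finally show ?thesis .
    qed
    ultimately have "?s \<le> 0" by (simp add: zero_le_mult_iff)
    then show ?thesis by simp
  qed
  with p(1) show ?thesis by blast
qed

lemma orth_proj:
  assumes "closed_csubspace W"
  shows "orth_proj W x \<in> W" "\<And>w. w \<in> W \<Longrightarrow> cinner (x - orth_proj W x) w = 0"
proof -
  have "\<exists>!p. p \<in> W \<and> (\<forall>w\<in>W. cinner (x - p) w = 0)"
  proof (rule ex_ex1I)
    show "\<exists>p. p \<in> W \<and> (\<forall>w\<in>W. cinner (x - p) w = 0)"
      using orthogonal_decomposition_exists[OF assms, of x] by blast
  next
    fix p q
    assume p: "p \<in> W \<and> (\<forall>w\<in>W. cinner (x - p) w = 0)"
      and q: "q \<in> W \<and> (\<forall>w\<in>W. cinner (x - q) w = 0)"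
    have "p - q \<in> W" using p q assms by (simp add: closed_csubspace_def subspace_diff)
    then have "cinner (x - q) (p - q) - cinner (x - p) (p - q) = 0" using p q by simp
    then have "cinner (p - q) (p - q) = 0"
      by (simp flip: cinner_diff_left)
    then show "p = q" by simp
  qed
  from theI'[OF this]
  show "orth_proj W x \<in> W" "\<And>w. w \<in> W \<Longrightarrow> cinner (x - orth_proj W x) w = 0"
    by (auto simp: orth_proj_def)
qed

lemma cinner_orth_proj:
  assumes "closed_csubspace W" "w \<in> W"
  shows "cinner w (orth_proj W x) = cinner w x"
proof -
  have "cinner w (x - orth_proj W x) = 0"
    using orth_proj(2)[OF assms(1) assms(2), of x] by (subst cinner_commute) simp
  then show ?thesis by (simp add: cinner_diff_right)
qed

section \<open>Adjoints\<close>

text \<open>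
  The representing vector spans the orthogonal complement of the kernel, which is a line
  because \<open>x - (f x / f z) z\<close> is in the kernel whenever \<open>f z \<noteq> 0\<close>.
\<close>
lemma Riesz_representation:
  fixes f :: "'a::chilbert_space \<Rightarrow> complex"
  assumes "bounded_clinear f"
  shows "\<exists>y. \<forall>x. f x = cinner x y"
proof (cases "\<forall>x. f x = 0")
  case True
  then have "\<forall>x. f x = cinner x 0" by simp
  then show ?thesis ..
next
  case False
  then obtain x0 where x0: "f x0 \<noteq> 0" by blast
  have bl: "bounded_linear f" and homogeneous: "\<And>c x. f (c *\<^sub>C x) = c * f x"
    using assms by (auto simp: bounded_clinear_def scaleC_complex_def)
  interpret bounded_linear f by (rule bl)
  have "closed {x. f x = 0}"
    by (intro closed_Collect_eq continuous_intros linear_continuous_on bl)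
  then have "closed_csubspace {x. f x = 0}"
    by (auto simp: closed_csubspace_def subspace_def homogeneous add scaleR)
  then obtain p where p: "f p = 0" and orth: "\<And>w. f w = 0 \<Longrightarrow> cinner (x0 - p) w = 0"
    using orthogonal_decomposition_exists[of "{x. f x = 0}" x0] by auto
  define z where "z = x0 - p"
  have fz: "f z \<noteq> 0" using x0 p by (simp add: z_def diff)
  then have z: "cinner z z \<noteq> 0" using zero by fastforce
  have "f x = cinner x (cnj (f z / cinner z z) *\<^sub>C z)" for x
  proof -
    have "f (x - (f x / f z) *\<^sub>C z) = 0" using fz by (simp add: diff homogeneous)
    then have "cinner z (x - (f x / f z) *\<^sub>C z) = 0" using orth by (simp add: z_def)
    then have "cinner (x - (f x / f z) *\<^sub>C z) z = 0" by (subst cinner_commute) simp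
    then have "cinner x z = f x / f z * cinner z z"
      by (simp add: cinner_diff_left cinner_scaleC_left)
    then show ?thesis using fz z by (simp add: cinner_scaleC_right)
  qed
  then show ?thesis by blast
qed

lemma cinner_cadjoint:
  fixes T :: "'a::chilbert_space \<Rightarrow> 'b::chilbert_space"
  assumes "bounded_clinear T"
  shows "cinner (T x) y = cinner x (cadjoint T y)"
proof -
  from assms have bl: "bounded_linear T" and homogeneous: "\<And>c x. T (c *\<^sub>C x) = c *\<^sub>C T x"
    by (auto simp: bounded_clinear_def)
  interpret bounded_linear T by (rule bl)
  have "\<exists>z. \<forall>x. cinner (T x) y = cinner x z" for y
  proof (rule Riesz_representation, unfold bounded_clinear_def, intro conjI allI)
    obtain K where K: "\<And>x. norm (T x) \<le> norm x * K" using bounded by blast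
    show "bounded_linear (\<lambda>x. cinner (T x) y)"
    proof (rule bounded_linear_intro[where K = "K * norm y"])
      show "norm (cinner (T x) y) \<le> norm x * (K * norm y)" for x
        using Cauchy_Schwarz_cinner[of "T x" y] mult_right_mono[OF K[of x], of "norm y"]
        by (simp add: mult.assoc)
    qed (simp_all add: add cinner_add_left scaleR, simp add: scaleR_scaleC cinner_scaleC_left
        scaleC_complex_def)
    show "cinner (T (c *\<^sub>C x)) y = c *\<^sub>C cinner (T x) y" for c x
      by (simp add: homogeneous cinner_scaleC_left scaleC_complex_def)
  qed
  then obtain S where S: "\<forall>x y. cinner (T x) y = cinner x (S y)" by metis
  have "\<exists>!S. \<forall>x y. cinner (T x) y = cinner x (S y)"
  proof (rule ex1I[of _ S], rule S)
    fix S' assume "\<forall>x y. cinner (T x) y = cinner x (S' y)"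
    with S have "cinner u (S' y) = cinner u (S y)" for u y by metis
    then show "S' = S" by (metis cinner_extensionality ext)
  qed
  from theI'[OF this] show ?thesis unfolding cadjoint_def by blast
qed

section \<open>The resolvent at one\<close>

lemma resolvent_at_one:
  assumes "1 \<notin> spectrum A"
  shows "\<exists>S. bounded_clinear S \<and> (\<forall>x. S (x - A x) = x) \<and> (\<forall>x. S x - A (S x) = x)"
proof -
  from assms obtain T where T: "bounded_clinear T" "\<And>x. T (A x - x) = x" "\<And>x. A (T x) - T x = x"
    by (auto simp: spectrum_def)
  \<comment> \<open>The definition of the spectrum inverts \<open>A - I\<close>, whence the sign change.\<close>
  show ?thesis
  proof (intro exI[of _ "\<lambda>x. T (- x)"] conjI allI)
    show "bounded_clinear (\<lambda>x. T (- x))"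
      using T(1) bounded_linear_compose[OF _ bounded_linear_minus[OF bounded_linear_ident], of T]
      by (simp add: bounded_clinear_def flip: scaleC_minus_right)
    show "T (- (x - A x)) = x" for x using T(2)[of x] by simp
    show "T (- x) - A (T (- x)) = x" for x using T(3)[of "- x"]
      by (metis minus_diff_eq minus_minus)
  qed
qed

text \<open>
  Moved across the inner product, \<open>I - A\<^sup>*\<close> becomes \<open>I - A\<close> and \<open>S\<^sup>*\<close> becomes \<open>S\<close>, in the reverse order:
  \<open>S\<close> as a left inverse makes \<open>I - A\<^sup>*\<close> surjective, as a right inverse it makes it injective.
\<close>
lemma inv_id_minus_cadjoint:
  fixes A :: "'a::chilbert_space \<Rightarrow> 'a"
  assumes "bounded_clinear A" "bounded_clinear S"
    and left: "\<And>x. S (x - A x) = x" and right: "\<And>x. S x - A (S x) = x"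
  shows "inv (\<lambda>x. x - cadjoint A x) y = cadjoint S y"
proof -
  have move: "cinner u (x - cadjoint A x) = cinner (u - A u) x" for u x
    by (simp add: cinner_diff_left cinner_diff_right cinner_cadjoint[OF assms(1)])
  have surj: "cadjoint S y - cadjoint A (cadjoint S y) = y"
    by (rule cinner_extensionality) (simp add: move left flip: cinner_cadjoint[OF assms(2)])
  have unique: "x = cadjoint S z" if "x - cadjoint A x = z" for x z
  proof (rule cinner_extensionality)
    fix u
    have "cinner u (cadjoint S z) = cinner (S u) (x - cadjoint A x)"
      by (simp add: cinner_cadjoint[OF assms(2)] that)
    also have "\<dots> = cinner u x" by (simp only: move right)
    finally show "cinner u x = cinner u (cadjoint S z)" by simp
  qed
  have "inj (\<lambda>x. x - cadjoint A x)" by (metis (mono_tags, lifting) injI unique)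
  then show ?thesis using surj by (rule inv_f_eq)
qed

section \<open>Recovery along stationary orbits\<close>

lemma orbit_stationary:
  assumes "A x + w = x"
  shows "orbit A x w n = x"
  by (induction n) (simp_all add: assms)

text \<open>
  A stationary orbit produces \<open>N\<close> equal rows, so the bound \<open>K\<close> of the recovery operator gives
  \<open>\<parallel>w\<parallel> \<le> K N s\<close>, where \<open>s\<close> is the \<open>\<ell>\<^sup>2\<close> norm of one row; hence \<open>c = 1 / (K N)\<^sup>2\<close>.
\<close>
lemma stable_recovery_lower_bound:
  assumes "stably_recoverable A g W N" "1 \<le> N"
    and summable: "\<And>h. summable (\<lambda>j. (cmod (cinner h (g j)))\<^sup>2)"
    and stationary: "\<And>w. A (S w) + w = S w"
  obtains c where "0 < c"
    "\<And>w. w \<in> W \<Longrightarrow> c * (norm w)\<^sup>2 \<le> (\<Sum>j. (cmod (cinner (S w) (g j)))\<^sup>2)"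
proof -
  from assms(1) obtain R where bounded: "bounded_matrix_operator N R"
    and R: "\<And>x0 w. w \<in> W \<Longrightarrow> R (measurements A g N x0 w) = w"
    unfolding stably_recoverable_def by blast
  from bounded obtain K where
    K: "\<And>D. D \<in> ell2_matrices N \<Longrightarrow> norm (R D) \<le> K * matrix_norm N D"
    unfolding bounded_matrix_operator_def by blast
  \<comment> \<open>The operator bound \<open>K\<close> may be zero or negative, so it is replaced by a positive one.\<close>
  define L where "L = max K 1 * real N"
  have L: "0 < L" using assms(2) by (simp add: L_def)
  show thesis
  proof (rule that[of "1 / L\<^sup>2"])
    show "0 < 1 / L\<^sup>2" using L by simp
    fix w assume "w \<in> W"
    let ?s = "\<Sum>j. (cmod (cinner (S w) (g j)))\<^sup>2"
    let ?D = "measurements A g N (S w) w"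
    have s: "0 \<le> ?s" by (simp add: suminf_nonneg summable)
    have D: "?D = (\<lambda>n j. if n < N then cinner (S w) (g j) else 0)"
      by (simp only: measurements_def orbit_stationary[of A "S w" w, OF stationary])
    have "norm w = norm (R ?D)" using R[OF \<open>w \<in> W\<close>] by simp
    also have "\<dots> \<le> K * matrix_norm N ?D"
      by (rule K) (simp add: D ell2_matrices_def summable)
    also have "\<dots> = K * (real N * sqrt ?s)" by (simp add: D matrix_norm_def)
    also have "\<dots> \<le> max K 1 * (real N * sqrt ?s)" using s by (intro mult_right_mono) auto
    finally have "norm w \<le> L * sqrt ?s" by (simp add: L_def)
    then have "(norm w)\<^sup>2 \<le> (L * sqrt ?s)\<^sup>2" by (intro power_mono) auto
    also have "\<dots> = L\<^sup>2 * ?s" using s by (simp add: power_mult_distrib)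
    finally show "1 / L\<^sup>2 * (norm w)\<^sup>2 \<le> ?s" using L by (simp add: field_simps)
  qed
qed

theorem theorem3p3:
  fixes g :: "nat \<Rightarrow> 'a::chilbert_space"
    and W :: "'a set"
    and A :: "'a \<Rightarrow> 'a"
  assumes "separable_space (euclidean :: 'a topology)"
    and "bessel_sequence g"
    and "closed_csubspace W"
    and "bounded_clinear A"
    and "1 \<notin> spectrum A"
    and "\<exists>N\<ge>1. stably_recoverable A g W N"
  shows "frame_for W (\<lambda>j. orth_proj W (inv (\<lambda>x. x - cadjoint A x) (g j)))"
proof -
  obtain S where S: "bounded_clinear S"
    and left: "\<And>x. S (x - A x) = x" and right: "\<And>x. S x - A (S x) = x"
    using resolvent_at_one[OF assms(5)] by blast
  from assms(2) obtain B where summable: "\<And>h. summable (\<lambda>j. (cmod (cinner h (g j)))\<^sup>2)"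
    and B: "\<And>h. (\<Sum>j. (cmod (cinner h (g j)))\<^sup>2) \<le> B * (norm h)\<^sup>2"
    unfolding bessel_sequence_def by blast
  have "A (S w) + w = S w" for w using right[of w] by (simp add: algebra_simps)
  with assms(6) summable obtain c where c: "0 < c"
    "\<And>w. w \<in> W \<Longrightarrow> c * (norm w)\<^sup>2 \<le> (\<Sum>j. (cmod (cinner (S w) (g j)))\<^sup>2)"
    by (metis stable_recovery_lower_bound)
  obtain M where M: "\<And>x. norm (S x) \<le> norm x * M"
    using S bounded_linear.bounded unfolding bounded_clinear_def by blast
  \<comment> \<open>When \<open>W\<close> is zero, \<open>c\<close> may exceed the upper bound from Bessel, and a frame requires \<open>c \<le> C\<close>;
     hence the maximum.\<close>
  have upper: "(\<Sum>j. (cmod (cinner (S w) (g j)))\<^sup>2) \<le> max c (\<bar>B\<bar> * M\<^sup>2) * (norm w)\<^sup>2" for w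
  proof -
    have "B * (norm (S w))\<^sup>2 \<le> \<bar>B\<bar> * (norm w * M)\<^sup>2"
      using M[of w] by (intro mult_mono power_mono) auto
    also have "\<dots> = \<bar>B\<bar> * M\<^sup>2 * (norm w)\<^sup>2" by (simp add: power_mult_distrib)
    also have "\<dots> \<le> max c (\<bar>B\<bar> * M\<^sup>2) * (norm w)\<^sup>2" by (intro mult_right_mono) auto
    finally show ?thesis using B[of "S w"] by linarith
  qed
  let ?f = "\<lambda>j. orth_proj W (inv (\<lambda>x. x - cadjoint A x) (g j))"
  have coefficient: "cinner w (?f j) = cinner (S w) (g j)" if "w \<in> W" for w j
    by (simp add: cinner_orth_proj[OF assms(3) that] cinner_cadjoint[OF S]
        inv_id_minus_cadjoint[OF assms(4) S left right])
  have "summable (\<lambda>j. (cmod (cinner w (?f j)))\<^sup>2) \<and>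
      c * (norm w)\<^sup>2 \<le> (\<Sum>j. (cmod (cinner w (?f j)))\<^sup>2) \<and>
      (\<Sum>j. (cmod (cinner w (?f j)))\<^sup>2) \<le> max c (\<bar>B\<bar> * M\<^sup>2) * (norm w)\<^sup>2" if "w \<in> W" for w
    unfolding coefficient[OF that] using summable c(2)[OF that] upper by blast
  moreover have "c \<le> max c (\<bar>B\<bar> * M\<^sup>2)" by simp
  ultimately show ?thesis
    unfolding frame_for_def using c(1) orth_proj(1)[OF assms(3)] by blast
qed

end
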